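(* Let $x\in\mathbb{R}$, $k\in\mathbb{Z}_{\ge0}$ and $n\in\mathbb{Z}_{>0}$ with $k\le x<k+\frac1n$. Then the $q$-deformation $[x]_q$ is a formal power series of the form $$[x]_q=[k]_q+q^{k+n}+\sum_{i\ge k+n+1}\kappa_i q^i$$ with integer coefficients $\kappa_i$, where $[k]_q=1+q+\cdots+q^{k-1}$ (and $[0]_q=0$).
   Context: For $a\in\mathbb{Z}$ put $[a]_q=\frac{1-q^a}{1-q}$ and $[a]_{q^{-1}}=\frac{1-q^{-a}}{1-q^{-1}}=q^{1-a}[a]_q$. For $x\in\mathbb{R}$ with regular continued fraction expansion $x=[a_1,a_2,a_3,\dots]=a_1+\cfrac{1}{a_2+\cfrac{1}{a_3+\cdots}}$ ($a_1\in\mathbb{Z}$, $a_i\ge1$ for $i\ge2$; finite iff $x$ is rational), the $q$-deformation of $x$ is $$[x]_q=[a_1]_q+\cfrac{q^{a_1}}{[a_2]_{q^{-1}}+\cfrac{q^{-a_2}}{[a_3]_q+\cfrac{q^{a_3}}{[a_4]_{q^{-1}}+\cfrac{q^{-a_4}}{\ddots}}}}.$$ For rational $x$ this is a rational function of $q$ (independent of the choice of the finite expansion), regarded as a Laurent series in $q$; for irrational $x$ the coefficients of the finite truncations stabilize and $[x]_q$ is their limit as a formal Laurent series.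
   Formalization: As stated the claim fails (x = k, or x = 1/3 with k = 0, n = 1, where [x]_q = q^2 − q^3 + …); the formal theorem keeps all hypotheses but includes the term q^{k+n} only when x ≥ k + 1/(n+1), and otherwise its coefficient is 0. *)

theory Defs
  imports Complex_Main "HOL-Computational_Algebra.Formal_Laurent_Series"
begin

section \<open>Regular continued fractions\<close>

text \<open>
  \<^term>\<open>cf_trunc n x\<close> lists the first \<open>n + 1\<close> partial quotients
  of the regular continued fraction of \<open>x\<close>, or all of them if there are fewer.
\<close>

fun cf_trunc :: "nat \<Rightarrow> real \<Rightarrow> int list" where
  "cf_trunc 0 x = [\<lfloor>x\<rfloor>]"
| "cf_trunc (Suc n) x = \<lfloor>x\<rfloor> # (if x \<in> \<int> then [] else cf_trunc n (1 / frac x))"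

fun cf_value :: "int list \<Rightarrow> real" where
  "cf_value [] = 0"
| "cf_value [a] = of_int a"
| "cf_value (a # b # bs) = of_int a + 1 / cf_value (b # bs)"


section \<open>The \<open>q\<close>-deformation\<close>

definition q_int :: "'a::field \<Rightarrow> int \<Rightarrow> 'a" where
  "q_int q a = (1 - q powi a) / (1 - q)"

text \<open>
  The deformed continued fraction alternates between \<open>q\<close> and its inverse; since
  \<open>inverse (inverse q) = q\<close>, this is obtained by inverting the parameter at each level.
\<close>

fun q_cf :: "'a::field \<Rightarrow> int list \<Rightarrow> 'a" where
  "q_cf q [] = 0"
| "q_cf q [a] = q_int q a"
| "q_cf q (a # b # bs) = q_int q a + q powi a / q_cf (inverse q) (b # bs)"

text \<open>
  The limit is taken in the \<open>X\<close>-adic metric of formal Laurent series, that is, coefficients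
  stabilize. For rational \<open>x\<close> the sequence is eventually constant, and evaluating the
  finite continued fraction in the field of Laurent series amounts to expanding the rational
  function at \<open>q = 0\<close>.
\<close>

definition q_real :: "real \<Rightarrow> rat fls" where
  "q_real x = lim (\<lambda>n. q_cf fls_X (cf_trunc n x))"


section \<open>Adequacy of the definitions\<close>

lemma cf_trunc_not_Nil [simp]: "cf_trunc n x \<noteq> []"
  by (cases n) auto

lemma cf_value_Cons: "bs \<noteq> [] \<Longrightarrow> cf_value (a # bs) = of_int a + 1 / cf_value bs"
  by (cases bs) auto

lemma inverse_frac_gt_1: "x \<notin> \<int> \<Longrightarrow> 1 < 1 / frac (x::real)"
  using frac_lt_1[of x] frac_gt_0_iff[of x] by (simp add: field_simps)

lemma cf_trunc_pos:
  assumes "1 \<le> x" "a \<in> set (cf_trunc n x)"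
  shows "1 \<le> a"
  using assms
proof (induction n arbitrary: x)
  case 0
  then show ?case by (simp add: le_floor_iff)
next
  case (Suc n)
  show ?case
  proof (cases "a = \<lfloor>x\<rfloor>")
    case True
    then show ?thesis using Suc.prems by (simp add: le_floor_iff)
  next
    case False
    then have "x \<notin> \<int>" "a \<in> set (cf_trunc n (1 / frac x))"
      using Suc.prems by (auto split: if_splits)
    then show ?thesis using Suc.IH[of "1 / frac x"] inverse_frac_gt_1[of x] by simp
  qed
qed

lemma cf_trunc_tl_pos: "a \<in> set (tl (cf_trunc n x)) \<Longrightarrow> 1 \<le> a"
proof (cases n)
  case (Suc m)
  assume "a \<in> set (tl (cf_trunc n x))"
  with Suc have "x \<notin> \<int>" "a \<in> set (cf_trunc m (1 / frac x))"
    by (auto split: if_splits)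
  then show ?thesis using cf_trunc_pos[of "1 / frac x" a m] inverse_frac_gt_1[of x] by simp
qed simp

lemma cf_value_Suc:
  "x \<notin> \<int> \<Longrightarrow> cf_value (cf_trunc (Suc n) x) = of_int \<lfloor>x\<rfloor> + 1 / cf_value (cf_trunc n (1 / frac x))"
  by (simp add: cf_value_Cons)

lemma cf_value_ge_1: "1 \<le> x \<Longrightarrow> 1 \<le> cf_value (cf_trunc n x)"
proof (induction n arbitrary: x)
  case 0
  then show ?case by (simp add: le_floor_iff)
next
  case (Suc n)
  have f: "1 \<le> real_of_int \<lfloor>x\<rfloor>" using Suc.prems by (simp add: le_floor_iff)
  show ?case
  proof (cases "x \<in> \<int>")
    case True
    then show ?thesis using f by simp
  next
    case False
    have "1 \<le> cf_value (cf_trunc n (1 / frac x))"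
      using Suc.IH inverse_frac_gt_1[OF False] by simp
    then have "0 \<le> 1 / cf_value (cf_trunc n (1 / frac x))" by simp
    then show ?thesis using f cf_value_Suc[OF False, of n] by linarith
  qed
qed

lemma cf_value_error: "\<bar>cf_value (cf_trunc n x) - x\<bar> \<le> 2 * (1/2) ^ n"
proof (induction n arbitrary: x rule: less_induct)
  case (less n)
  have step: "cf_value (cf_trunc (Suc m) z) - z = (w - v) / (v * w)"
    if "z \<notin> \<int>" "w = 1 / frac z" "v = cf_value (cf_trunc m w)" for m z w v
  proof -
    have w: "1 < w" using inverse_frac_gt_1 that by simp
    then have v: "1 \<le> v" using cf_value_ge_1 that by simp
    have "z = of_int \<lfloor>z\<rfloor> + 1 / w" using that by (simp add: frac_def)
    moreover have "cf_value (cf_trunc (Suc m) z) = of_int \<lfloor>z\<rfloor> + 1 / v"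
      using cf_value_Suc that by simp
    ultimately have "cf_value (cf_trunc (Suc m) z) - z = 1 / v - 1 / w" by linarith
    then show ?thesis using v w by (simp add: field_simps)
  qed
  have int: ?case if "x \<in> \<int>"
    using that by (cases n) (auto elim!: Ints_cases)
  consider "n = 0" | "x \<in> \<int>" | "n = 1" "x \<notin> \<int>" | m where "n = Suc (Suc m)" "x \<notin> \<int>"
    by (metis One_nat_def not0_implies_Suc)
  then show ?case
  proof cases
    case 1
    have "\<bar>real_of_int \<lfloor>x\<rfloor> - x\<bar> \<le> 2" by linarith
    with 1 show ?thesis by simp
  next
    case 2
    then show ?thesis by (rule int)
  next
    case 3
    define w where "w = 1 / frac x"
    define v where "v = cf_value (cf_trunc 0 w)"
    have w: "1 < w" using inverse_frac_gt_1 3 w_def by simp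
    have v: "1 \<le> v" using cf_value_ge_1 w v_def less_imp_le by blast
    have vw: "1 \<le> v * w" using v w mult_mono[of 1 v 1 w] by simp
    have "\<bar>w - v\<bar> \<le> 1" unfolding v_def by simp linarith
    then have "\<bar>w - v\<bar> / (v * w) \<le> 1" using vw by (simp add: field_simps)
    then show ?thesis
      using step[OF 3(2) w_def v_def] 3(1) v w by (simp add: abs_mult abs_divide)
  next
    case 4
    define w where "w = 1 / frac x"
    define v where "v = cf_value (cf_trunc (Suc m) w)"
    have w: "1 < w" using inverse_frac_gt_1 4 w_def by simp
    have v: "1 \<le> v" using cf_value_ge_1 w v_def less_imp_le by blast
    have vw: "1 \<le> v * w" using v w mult_mono[of 1 v 1 w] by simp
    have eq: "\<bar>cf_value (cf_trunc n x) - x\<bar> = \<bar>w - v\<bar> / (v * w)"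
      using step[OF 4(2) w_def v_def] 4(1) v w by (simp add: abs_mult abs_divide)
    show ?thesis
    proof (cases "w \<in> \<int>")
      case True
      then have "v = w" unfolding v_def by (auto elim!: Ints_cases)
      then show ?thesis using eq by simp
    next
      case False
      define w' where "w' = 1 / frac w"
      define v' where "v' = cf_value (cf_trunc m w')"
      have w': "1 < w'" using inverse_frac_gt_1 False w'_def by simp
      have v': "1 \<le> v'" using cf_value_ge_1 w' v'_def less_imp_le by blast
      have a: "1 \<le> real_of_int \<lfloor>w\<rfloor>" using w by (simp add: le_floor_iff)
      have W: "w = of_int \<lfloor>w\<rfloor> + 1 / w'" using w'_def by (simp add: frac_def)
      have V: "v = of_int \<lfloor>w\<rfloor> + 1 / v'"
        using cf_value_Suc[OF False, of m] unfolding v_def v'_def w'_def by simp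
      have "w * w' = of_int \<lfloor>w\<rfloor> * w' + 1"
        using w' by (subst W) (simp add: field_simps)
      moreover have "1 * 1 \<le> of_int \<lfloor>w\<rfloor> * w'" using a w' by (intro mult_mono) auto
      ultimately have ww: "2 \<le> w * w'" by linarith
      have "v * v' = of_int \<lfloor>w\<rfloor> * v' + 1"
        using v' by (subst V) (simp add: field_simps)
      moreover have "1 * 1 \<le> of_int \<lfloor>w\<rfloor> * v'" using a v' by (intro mult_mono) auto
      ultimately have vv: "2 \<le> v * v'" by linarith
      have four: "4 \<le> (v * v') * (w * w')" using mult_mono[OF vv ww] vv by simp
      have "\<bar>w - v\<bar> = \<bar>w' - v'\<bar> / (v' * w')"
        using step[OF False w'_def v'_def] v' w' unfolding v_def[symmetric]
        by (metis abs_divide abs_minus_commute abs_of_pos less_le_trans mult_pos_pos zero_less_one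
            less_trans)
      then have "\<bar>cf_value (cf_trunc n x) - x\<bar> = \<bar>w' - v'\<bar> / ((v * v') * (w * w'))"
        using eq by (simp add: mult_ac)
      also have "\<dots> \<le> \<bar>w' - v'\<bar> / 4"
        using four by (intro divide_left_mono) auto
      also have "\<dots> \<le> 2 * (1/2) ^ m / 4"
        using less.IH[of m w'] 4(1) unfolding v'_def by (simp add: abs_minus_commute)
      finally show ?thesis using 4(1) by simp
    qed
  qed
qed

lemma cf_value_tendsto: "(\<lambda>n. cf_value (cf_trunc n x)) \<longlonglongrightarrow> x"
proof -
  have "(\<lambda>n. 2 * (1/2) ^ n :: real) \<longlonglongrightarrow> 2 * 0"
    by (intro tendsto_mult tendsto_const LIMSEQ_power_zero) auto
  then have g: "(\<lambda>n. 2 * (1/2) ^ n :: real) \<longlonglongrightarrow> 0" by simp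
  have "(\<lambda>n. \<bar>cf_value (cf_trunc n x) - x\<bar>) \<longlonglongrightarrow> 0"
    by (rule tendsto_sandwich[OF _ _ tendsto_const g])
      (rule always_eventually, rule allI, rule abs_ge_zero cf_value_error)+
  from LIM_zero_cancel[OF tendsto_rabs_zero_cancel[OF this]] show ?thesis .
qed

lemma cf_trunc_rational:
  assumes "x \<in> \<rat>"
  shows "\<exists>N. cf_value (cf_trunc N x) = x \<and> (\<forall>n\<ge>N. cf_trunc n x = cf_trunc N x)"
proof -
  have "\<exists>N. cf_value (cf_trunc N x) = x \<and> (\<forall>n\<ge>N. cf_trunc n x = cf_trunc N x)"
    if "x = of_int p / of_nat d" "0 < d" for x :: real and p :: int and d :: nat
    using that
  proof (induction d arbitrary: x p rule: less_induct)
    case (less d)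
    show ?case
    proof (cases "x \<in> \<int>")
      case True
      then have "cf_trunc n x = [\<lfloor>x\<rfloor>]" for n by (cases n) auto
      then show ?thesis using True by (auto elim!: Ints_cases)
    next
      case False
      define r where "r = p - \<lfloor>x\<rfloor> * int d"
      have fr: "frac x = of_int r / of_nat d"
        using less.prems by (simp add: frac_def r_def field_simps)
      have "0 < frac x" "frac x < 1" using False frac_lt_1 frac_gt_0_iff by auto
      then have r: "0 < r" "r < int d"
        using less.prems(2) unfolding fr by (auto simp: field_simps)
      have y: "1 / frac x = of_int (int d) / of_nat (nat r)" using r fr by simp
      obtain N where N: "cf_value (cf_trunc N (1 / frac x)) = 1 / frac x"
        "\<And>n. n \<ge> N \<Longrightarrow> cf_trunc n (1 / frac x) = cf_trunc N (1 / frac x)"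
        using less.IH[OF _ y] r by (metis zero_less_nat_eq nat_less_iff less_imp_le)
      have "cf_value (cf_trunc (Suc N) x) = x"
        using cf_value_Suc[OF False, of N] N(1) by (simp add: frac_def)
      moreover have "cf_trunc n x = cf_trunc (Suc N) x" if "n \<ge> Suc N" for n
      proof -
        obtain m where m: "n = Suc m" "m \<ge> N" using \<open>n \<ge> Suc N\<close> by (cases n) auto
        show ?thesis unfolding m(1) cf_trunc.simps N(2)[OF m(2)] ..
      qed
      ultimately show ?thesis by blast
    qed
  qed
  moreover obtain p d where "x = of_int p / of_int d" "d > 0"
    using assms by (auto elim!: Rats_cases')
  then have "x = of_int p / of_nat (nat d)" "0 < nat d" by auto
  ultimately show ?thesis by blast
qed

lemma q_real_rational:
  assumes "x \<in> \<rat>"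
  obtains N where "cf_value (cf_trunc N x) = x" "q_real x = q_cf fls_X (cf_trunc N x)"
proof -
  obtain N where N: "cf_value (cf_trunc N x) = x" "\<forall>n\<ge>N. cf_trunc n x = cf_trunc N x"
    using cf_trunc_rational[OF assms] by blast
  have "(\<lambda>n. q_cf fls_X (cf_trunc n x) :: rat fls) \<longlonglongrightarrow> q_cf fls_X (cf_trunc N x)"
    using N(2) by (intro tendsto_eventually) (metis (mono_tags, lifting) eventually_sequentially)
  then have "q_real x = q_cf fls_X (cf_trunc N x)" unfolding q_real_def by (rule limI)
  with N(1) show ?thesis by (rule that)
qed

text \<open>
  By the next two facts the coefficient of \<open>q ^ (k + n)\<close> in the deformation of
  \<open>x \<in> {k..<k + 1 / n}\<close> need not be \<open>1\<close>: it is \<open>0\<close> for \<open>x = k\<close>, and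
  for \<open>k = 0\<close>, \<open>n = 1\<close>, \<open>x = 1 / 3\<close>.
\<close>

lemma q_real_of_int: "q_real (of_int k) = q_int fls_X k"
proof -
  have "cf_trunc n (of_int k) = [k]" for n by (cases n) auto
  then show ?thesis by (simp add: q_real_def)
qed

lemma q_real_one_third: "q_real (1 / 3) = fls_X ^ 2 / (1 + fls_X + fls_X ^ 2)"
proof -
  have fr: "frac (1 / 3 :: real) = 1 / 3" by (simp add: frac_eq)
  have ni: "(1 / 3 :: real) \<notin> \<int>"
    using fr frac_eq_0_iff[of "1 / 3 :: real"] by simp
  have three: "cf_trunc n 3 = [3]" for n by (cases n) auto
  have "cf_trunc (Suc n) (1 / 3) = [0, 3]" for n
    using ni fr three by simp
  then have "\<forall>n\<ge>1. cf_trunc n (1 / 3) = [0, 3]" by (metis One_nat_def Suc_le_D)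
  then have "(\<lambda>n. q_cf fls_X (cf_trunc n (1 / 3)) :: rat fls) \<longlonglongrightarrow> q_cf fls_X [0, 3]"
    by (intro tendsto_eventually) (auto simp: eventually_sequentially intro!: exI[of _ 1])
  then have "q_real (1 / 3) = q_cf fls_X [0, 3]" unfolding q_real_def by (rule limI)
  also have "\<dots> = fls_X ^ 2 / (1 + fls_X + fls_X ^ 2)"
  proof -
    have X: "(fls_X :: rat fls) \<noteq> 0" "(fls_X :: rat fls) \<noteq> 1"
      by (auto simp: fls_eq_iff intro: exI[of _ 1])
    have "q_cf q [0, 3] = q ^ 2 / (1 + q + q ^ 2)" if "q \<noteq> 0" "q \<noteq> 1" for q :: "rat fls"
    proof -
      have "inverse q \<noteq> 1" using that by (metis inverse_1 inverse_inverse_eq)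
      have "1 - inverse q ^ 3 = (1 + inverse q + inverse q ^ 2) * (1 - inverse q)"
        by (simp add: algebra_simps power2_eq_square power3_eq_cube)
      then have "(1 - inverse q ^ 3) / (1 - inverse q) = 1 + inverse q + inverse q ^ 2"
        using \<open>inverse q \<noteq> 1\<close> by simp
      also have "\<dots> = (1 + q + q ^ 2) / q ^ 2"
        using that by (simp add: field_simps power2_eq_square)
      finally have e: "(1 - inverse q ^ 3) / (1 - inverse q) = (1 + q + q ^ 2) / q ^ 2" .
      have "q_cf q [0, 3] = 1 / ((1 - inverse q ^ 3) / (1 - inverse q))"
        by (simp add: q_int_def power_int_def)
      then show ?thesis unfolding e by simp
    qed
    then show ?thesis using X by blast
  qed
  finally show ?thesis .
qed

end

theory Submission
  imports Defs
begin

text \<open>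
  Two consecutive levels of the deformed continued fraction combine into the map
  \[ g \mapsto [a]_q + \frac{q^a}{[b]_{q^{-1}} + q^{-b} / g}
       = [a]_q + \frac{q^{a+b}}{q [b]_q + 1 / g}, \]
  where \<open>1 / g\<close> is read as \<open>0\<close> if the continued fraction stops at \<open>b\<close>. For \<open>a, b \<ge> 1\<close> it
  preserves the group of one-units \<open>1 + q \<int>[[q]]\<close> and multiplies differences by \<open>q\<^bsup>a+b\<^esup>\<close> times a one-unit, so the
  truncations converge. The denominator is a one-unit, or \<open>q\<close> times a one-unit if the fraction
  stops at \<open>b\<close>; in both cases the first correction to \<open>[\<lfloor>x\<rfloor>]\<^sub>q\<close>, for \<open>x \<notin> \<int>\<close>, is \<open>q\<close> to the power
  \<open>\<lfloor>x\<rfloor> + \<lceil>1 / frac x\<rceil> - 1\<close>. For \<open>k < x < k + 1 / n\<close> this exponent is at least \<open>k + n\<close>, with equality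
  if and only if \<open>k + 1 / (n + 1) \<le> x\<close>.
\<close>

unbundle fps_syntax

section \<open>Laurent series with integer coefficients\<close>

lemma tendsto_flsI:
  fixes f :: "'b \<Rightarrow> 'a::group_add fls"
  assumes "\<And>N. \<forall>\<^sub>F x in F. \<forall>i<int N. f x $$ i = l $$ i"
  shows "(f \<longlongrightarrow> l) F"
proof (rule tendstoI)
  fix e :: real assume "0 < e"
  then obtain N where N: "inverse (2 ^ N) < e"
    using real_arch_pow_inv[of e "1/2"] by (auto simp: power_one_over inverse_eq_divide)
  show "\<forall>\<^sub>F x in F. dist (f x) l < e"
    using assms[of N]
  proof eventually_elim
    case (elim x)
    show ?case
    proof (cases "f x = l")
      case False
      then have deg: "int N \<le> fls_subdegree (f x - l)"
        using elim by (intro fls_subdegree_geI) auto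
      then have "dist (f x) l = inverse (2 ^ nat (fls_subdegree (f x - l)))"
        using False by (simp add: dist_fls_def)
      also have "\<dots> \<le> inverse (2 ^ N)"
        using deg by (intro le_imp_inverse_le power_increasing) auto
      finally show ?thesis using N by linarith
    qed (use \<open>0 < e\<close> in simp)
  qed
qed

definition fls_Ints_ge :: "int \<Rightarrow> 'a::ring_1 fls set" where
  "fls_Ints_ge n = {f. (\<forall>i. f $$ i \<in> \<int>) \<and> (\<forall>i<n. f $$ i = 0)}"

lemma fls_Ints_ge_nth_eq_0: "f \<in> fls_Ints_ge n \<Longrightarrow> i < n \<Longrightarrow> f $$ i = 0"
  by (simp add: fls_Ints_ge_def)

lemma fls_Ints_ge_nth_Ints: "f \<in> fls_Ints_ge n \<Longrightarrow> f $$ i \<in> \<int>"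
  by (simp add: fls_Ints_ge_def)

lemma fls_Ints_ge_antimono: "f \<in> fls_Ints_ge n \<Longrightarrow> m \<le> n \<Longrightarrow> f \<in> fls_Ints_ge m"
  by (simp add: fls_Ints_ge_def)

lemma zero_in_fls_Ints_ge: "0 \<in> fls_Ints_ge n"
  by (simp add: fls_Ints_ge_def)

lemma one_in_fls_Ints_ge: "1 \<in> fls_Ints_ge 0"
  by (simp add: fls_Ints_ge_def)

lemma fls_Ints_ge_add: "f \<in> fls_Ints_ge n \<Longrightarrow> g \<in> fls_Ints_ge n \<Longrightarrow> f + g \<in> fls_Ints_ge n"
  by (simp add: fls_Ints_ge_def)

lemma fls_Ints_ge_uminus: "f \<in> fls_Ints_ge n \<Longrightarrow> - f \<in> fls_Ints_ge n"
  by (simp add: fls_Ints_ge_def)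

lemma fls_Ints_ge_diff: "f \<in> fls_Ints_ge n \<Longrightarrow> g \<in> fls_Ints_ge n \<Longrightarrow> f - g \<in> fls_Ints_ge n"
  by (simp add: fls_Ints_ge_def)

lemma fls_Ints_ge_diff_trans:
  "f - g \<in> fls_Ints_ge n \<Longrightarrow> g - h \<in> fls_Ints_ge n \<Longrightarrow> f - h \<in> fls_Ints_ge n"
  using fls_Ints_ge_add[of "f - g" n "g - h"] by simp

lemma fls_Ints_ge_mult:
  assumes "f \<in> fls_Ints_ge m" "g \<in> fls_Ints_ge n"
  shows "f * g \<in> fls_Ints_ge (m + n)"
proof -
  have "(f * g) $$ i \<in> \<int>" for i
    using assms unfolding fls_times_nth(2)
    by (intro Ints_sum Ints_mult) (auto intro: fls_Ints_ge_nth_Ints)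
  moreover have "(f * g) $$ i = 0" if "i < m + n" for i
    unfolding fls_times_nth(2)
  proof (rule sum.neutral, rule ballI)
    fix j
    have "j < m \<or> i - j < n" using that by linarith
    then show "f $$ j * g $$ (i - j) = 0"
      using assms by (auto dest: fls_Ints_ge_nth_eq_0)
  qed
  ultimately show ?thesis by (simp add: fls_Ints_ge_def)
qed

lemma fls_Ints_ge_power: "f \<in> fls_Ints_ge m \<Longrightarrow> f ^ n \<in> fls_Ints_ge (int n * m)"
proof (induction n)
  case (Suc n)
  then show ?case using fls_Ints_ge_mult[of f m "f ^ n" "int n * m"] by (simp add: algebra_simps)
qed (simp add: one_in_fls_Ints_ge)

lemma fls_X_powi_in_fls_Ints_ge: "(fls_X :: 'a::division_ring fls) powi n \<in> fls_Ints_ge n"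
  by (simp add: fls_Ints_ge_def)

lemma fls_Ints_ge_all_imp_eq_0:
  assumes "\<And>n. f \<in> fls_Ints_ge (int n)"
  shows "f = 0"
proof (rule fls_eqI)
  fix i
  show "f $$ i = 0 $$ i"
    using fls_Ints_ge_nth_eq_0[OF assms, of i "nat (i + 1)"] by simp
qed

lemma fls_Ints_ge_complete:
  fixes s :: "nat \<Rightarrow> 'a::ring_1 fls"
  assumes "\<And>n. s (Suc n) - s n \<in> fls_Ints_ge (c + int n)"
  shows "\<exists>l. \<forall>n. l - s n \<in> fls_Ints_ge (c + int n)"
proof (intro exI allI)
  have cauchy: "s m - s n \<in> fls_Ints_ge (c + int n)" if "n \<le> m" for m n
    using that
  proof (induction m rule: dec_induct)
    case base
    show ?case by (simp add: zero_in_fls_Ints_ge)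
  next
    case (step m)
    have "s (Suc m) - s m \<in> fls_Ints_ge (c + int n)"
      using assms[of m] by (rule fls_Ints_ge_antimono) (use step(1) in simp)
    from this step.IH show ?case by (rule fls_Ints_ge_diff_trans)
  qed
  define index where "index i = nat (i + 1 - c)" for i
  define l where "l = Abs_fls (\<lambda>i. s (index i) $$ i)"
  have "\<forall>i < min c (fls_subdegree (s 0)). s (index i) $$ i = 0"
    by (simp add: index_def)
  then have l_nth: "l $$ i = s (index i) $$ i" for i
    unfolding l_def by (rule nth_Abs_fls_lower_bound)
  have stable: "l $$ i = s m $$ i" if "index i \<le> m" for i m
    using fls_Ints_ge_nth_eq_0[OF cauchy[OF that], of i] by (simp add: l_nth index_def)
  show "l - s n \<in> fls_Ints_ge (c + int n)" for n
  proof -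
    have "(l - s n) $$ i = (s (max n (index i)) - s n) $$ i" for i
      by (simp add: stable[of i "max n (index i)"])
    with cauchy[of n "max n (index _)"] show ?thesis by (simp add: fls_Ints_ge_def)
  qed
qed

lemma fls_Ints_ge_LIMSEQ:
  assumes "\<And>n. l - s n \<in> fls_Ints_ge (c + int n)"
  shows "s \<longlonglongrightarrow> l"
proof (rule tendsto_flsI)
  fix N
  have "s n $$ i = l $$ i" if "nat (int N - c) \<le> n" "i < int N" for n i
    using fls_Ints_ge_nth_eq_0[OF assms, of i n] that by simp
  then show "\<forall>\<^sub>F n in sequentially. \<forall>i<int N. s n $$ i = l $$ i"
    by (auto simp: eventually_sequentially)
qed

lemma fls_Ints_ge_imp_fps_to_fls:
  assumes "f \<in> fls_Ints_ge (int n)"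
  obtains \<kappa> :: "nat \<Rightarrow> int"
    where "f = fps_to_fls (Abs_fps (\<lambda>i. if n \<le> i then of_int (\<kappa> i) else 0))"
proof -
  have "\<forall>i. \<exists>z. f $$ (int i) = of_int z"
    using fls_Ints_ge_nth_Ints[OF assms] by (metis Ints_cases)
  then obtain \<kappa> where \<kappa>: "\<And>i. f $$ (int i) = of_int (\<kappa> i)" by metis
  have "f = fps_to_fls (Abs_fps (\<lambda>i. if n \<le> i then of_int (\<kappa> i) else 0))"
  proof (rule fls_eqI)
    fix i
    show "f $$ i = fps_to_fls (Abs_fps (\<lambda>i. if n \<le> i then of_int (\<kappa> i) else 0)) $$ i"
      using fls_Ints_ge_nth_eq_0[OF assms, of i] \<kappa>[of "nat i"] by auto
  qed
  then show ?thesis by (rule that)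
qed

definition fls_one_units :: "'a::ring_1 fls set" where
  "fls_one_units = {u. u - 1 \<in> fls_Ints_ge 1}"

lemma fls_one_units_in_fls_Ints_ge: "u \<in> fls_one_units \<Longrightarrow> u \<in> fls_Ints_ge 0"
  using fls_Ints_ge_add[OF fls_Ints_ge_antimono[of "u - 1" 1 0] one_in_fls_Ints_ge]
  by (simp add: fls_one_units_def)

lemma fls_one_units_nonzero: "u \<in> fls_one_units \<Longrightarrow> u \<noteq> 0"
  using fls_Ints_ge_nth_eq_0[of "u - 1" 1 0] by (auto simp: fls_one_units_def)

lemma fls_one_units_diff_trans:
  "f - u \<in> fls_Ints_ge 1 \<Longrightarrow> u \<in> fls_one_units \<Longrightarrow> f \<in> fls_one_units"
  by (auto simp: fls_one_units_def intro: fls_Ints_ge_diff_trans)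

lemma fls_one_units_inverse:
  fixes u :: "'a::field fls"
  assumes "u \<in> fls_one_units"
  shows "inverse u \<in> fls_one_units"
proof -
  define s where "s n = (\<Sum>i<n. (1 - u) ^ i)" for n
  have "1 - u \<in> fls_Ints_ge 1"
    using assms fls_Ints_ge_uminus[of "u - 1" 1] by (simp add: fls_one_units_def)
  then have power: "(1 - u) ^ n \<in> fls_Ints_ge (int n)" for n
    using fls_Ints_ge_power[of "1 - u" 1 n] by simp
  then have "s (Suc n) - s n \<in> fls_Ints_ge (0 + int n)" for n
    by (simp add: s_def)
  then obtain l where l: "\<And>n. l - s n \<in> fls_Ints_ge (0 + int n)"
    using fls_Ints_ge_complete[of s 0] by blast
  have "u * l - 1 = 0"
  proof (rule fls_Ints_ge_all_imp_eq_0)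
    fix n
    have "1 - (1 - u) ^ n = u * s n"
      using one_diff_power_eq[of "1 - u" n] by (simp add: s_def)
    then have "u * l - 1 = u * (l - s n) - (1 - u) ^ n"
      by (simp add: algebra_simps)
    also have "\<dots> \<in> fls_Ints_ge (int n)"
      using fls_Ints_ge_mult[OF fls_one_units_in_fls_Ints_ge[OF assms] l[of n]] power[of n]
      by (simp add: fls_Ints_ge_diff)
    finally show "u * l - 1 \<in> fls_Ints_ge (int n)" .
  qed
  then have "inverse u = l" by (intro inverse_unique) simp
  then show ?thesis using l[of 1] by (simp add: fls_one_units_def s_def)
qed

lemma fls_one_units_inverse_diff:
  fixes u v :: "'a::field fls"
  assumes "u \<in> fls_one_units" "v \<in> fls_one_units" "u - v \<in> fls_Ints_ge n"
  shows "inverse u - inverse v \<in> fls_Ints_ge n"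
proof -
  have "inverse u * (u - v) * inverse v \<in> fls_Ints_ge (0 + n + 0)"
    using assms by (intro fls_Ints_ge_mult fls_one_units_in_fls_Ints_ge fls_one_units_inverse)
  then show ?thesis
    using assms(1,2) by (simp add: inverse_diff_inverse fls_one_units_nonzero fls_Ints_ge_uminus)
qed

section \<open>Deformed continued fractions\<close>

lemma q_int_inverse:
  fixes q :: "'a::field"
  assumes "q \<noteq> 0"
  shows "q_int (inverse q) a = q powi (- a) * (q * q_int q a)"
proof (cases "q = 1")
  case True
  then show ?thesis by (simp add: q_int_def)
next
  case False
  then have "1 - q \<noteq> 0" "q - 1 \<noteq> 0" by auto
  with assms show ?thesis
    by (simp add: q_int_def power_int_minus power_int_inverse field_simps)
qed

text \<open>Since \<open>inverse 0 = 0\<close> and \<open>q_cf q [] = 0\<close>, the next two equations hold for \<open>bs = []\<close> as well.\<close>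

lemma q_cf_Cons: "q_cf q (a # bs) = q_int q a + q powi a * inverse (q_cf (inverse q) bs)"
  by (cases bs) (simp_all add: divide_inverse)

declare q_cf.simps(3) [simp del]

lemma q_cf_Cons_Cons:
  fixes q :: "'a::field"
  assumes "q \<noteq> 0"
  shows "q_cf q (a # b # bs)
    = q_int q a + q powi (a + b) * inverse (q * q_int q b + inverse (q_cf q bs))"
proof -
  have "q_cf (inverse q) (b # bs) = q powi (- b) * (q * q_int q b + inverse (q_cf q bs))"
    using assms
    by (simp add: q_cf_Cons q_int_inverse power_int_minus power_int_inverse distrib_left)
  then show ?thesis
    using assms by (simp add: q_cf_Cons[of q a] power_int_add power_int_minus)
qed

lemma fls_X_neq_1: "(fls_X :: 'a::field fls) \<noteq> 1"
  by (auto simp: fls_eq_iff intro: exI[of _ 1])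

lemma q_int_fls_X_nth:
  "(q_int fls_X (int n) :: 'a::field fls) $$ i = of_bool (0 \<le> i \<and> i < int n)"
proof -
  have "q_int fls_X (int n) = (\<Sum>i<n. (fls_X :: 'a fls) ^ i)"
    by (simp add: q_int_def sum_gp_strict fls_X_neq_1)
  then show ?thesis
    by (cases i) (auto simp: fls_nth_sum)
qed

lemma q_int_fls_X_eq_fps_to_fls: "q_int fls_X (int n) = fps_to_fls (\<Sum>i<n. fps_X ^ i)"
  by (rule fls_eqI) (auto simp: q_int_fls_X_nth fps_sum_nth)

lemma q_int_one_unit:
  assumes "1 \<le> a"
  shows "q_int fls_X a \<in> fls_one_units"
proof -
  obtain n where "a = int n" "1 \<le> n" using assms by (cases a) auto
  then show ?thesis by (auto simp: fls_one_units_def fls_Ints_ge_def q_int_fls_X_nth)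
qed

lemma q_cf_denominator_one_unit:
  fixes g :: "'a::field fls"
  assumes "1 \<le> b" "g \<in> fls_one_units"
  shows "fls_X * q_int fls_X b + inverse g \<in> fls_one_units"
proof (rule fls_one_units_diff_trans)
  have "fls_X * q_int fls_X b \<in> (fls_Ints_ge (1 + 0) :: 'a fls set)"
    using assms(1) fls_X_powi_in_fls_Ints_ge[of 1]
    by (intro fls_Ints_ge_mult fls_one_units_in_fls_Ints_ge q_int_one_unit) auto
  then show "fls_X * q_int fls_X b + inverse g - inverse g \<in> fls_Ints_ge 1" by simp
  show "inverse g \<in> fls_one_units" using assms(2) by (rule fls_one_units_inverse)
qed

lemma q_cf_Cons_Cons_leading_terms:
  assumes "1 \<le> b" and "bs \<noteq> [] \<Longrightarrow> (q_cf fls_X bs :: 'a::field fls) \<in> fls_one_units"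
    and e: "e = a + b - of_bool (bs = [])"
  shows "q_cf fls_X (a # b # bs) - (q_int fls_X a + fls_X powi e)
    \<in> (fls_Ints_ge (e + 1) :: 'a fls set)"
proof -
  obtain u :: "'a fls" where u: "u \<in> fls_one_units"
    and q_cf: "q_cf fls_X (a # b # bs) = q_int fls_X a + fls_X powi e * u"
  proof (cases "bs = []")
    case True
    then have "q_cf fls_X (a # b # bs) = q_int fls_X a
        + fls_X powi e * inverse (q_int fls_X b :: 'a fls)"
      by (simp add: q_cf_Cons_Cons e power_int_diff divide_inverse del: fls_X_power_int)
    with assms(1) show ?thesis
      by (intro that[of "inverse (q_int fls_X b)"] fls_one_units_inverse q_int_one_unit)
  next
    case False
    then have "q_cf fls_X (a # b # bs) = q_int fls_X a
        + fls_X powi e * inverse (fls_X * q_int fls_X b + inverse (q_cf fls_X bs :: 'a fls))"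
      by (simp add: q_cf_Cons_Cons e del: fls_X_power_int)
    with False assms(1,2) show ?thesis
      by (intro that[of "inverse (fls_X * q_int fls_X b + inverse (q_cf fls_X bs))"]
          fls_one_units_inverse q_cf_denominator_one_unit)
  qed
  have "fls_X powi e * (u - 1) \<in> fls_Ints_ge (e + 1)"
    using u by (intro fls_Ints_ge_mult fls_X_powi_in_fls_Ints_ge) (simp add: fls_one_units_def)
  then show ?thesis
    by (simp add: q_cf right_diff_distrib del: fls_X_power_int)
qed

lemma q_cf_Cons_Cons_diff_q_int:
  assumes "1 \<le> b" and "bs \<noteq> [] \<Longrightarrow> (q_cf fls_X bs :: 'a::field fls) \<in> fls_one_units"
  shows "q_cf fls_X (a # b # bs) - q_int fls_X a \<in> (fls_Ints_ge (a + b - 1) :: 'a fls set)"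
proof (rule fls_Ints_ge_diff_trans)
  define e where "e = a + b - of_bool (bs = [])"
  show "q_cf fls_X (a # b # bs) - (q_int fls_X a + fls_X powi e)
      \<in> (fls_Ints_ge (a + b - 1) :: 'a fls set)"
    by (rule fls_Ints_ge_antimono[OF q_cf_Cons_Cons_leading_terms[OF assms e_def]])
      (simp_all add: e_def)
  have "fls_X powi e \<in> (fls_Ints_ge (a + b - 1) :: 'a fls set)"
    by (rule fls_Ints_ge_antimono[OF fls_X_powi_in_fls_Ints_ge]) (simp add: e_def)
  then show "q_int fls_X a + fls_X powi e - q_int fls_X a
      \<in> (fls_Ints_ge (a + b - 1) :: 'a fls set)"
    by simp
qed

lemma q_cf_one_unit:
  assumes "bs \<noteq> []" "\<forall>b\<in>set bs. 1 \<le> b"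
  shows "q_cf fls_X bs \<in> (fls_one_units :: 'a::field fls set)"
  using assms
proof (induction bs rule: induct_list012)
  case 1
  then show ?case by simp
next
  case (2 a)
  then show ?case by (simp add: q_int_one_unit)
next
  case (3 a b bs)
  show ?case
  proof (rule fls_one_units_diff_trans)
    show "q_cf fls_X (a # b # bs) - q_int fls_X a \<in> (fls_Ints_ge 1 :: 'a fls set)"
      using 3 by (intro fls_Ints_ge_antimono[OF q_cf_Cons_Cons_diff_q_int]) auto
    show "q_int fls_X a \<in> (fls_one_units :: 'a fls set)"
      using 3 by (intro q_int_one_unit) simp
  qed
qed

lemma q_cf_Cons_Cons_diff:
  fixes n :: int
  assumes "1 \<le> b"
    and units: "(q_cf fls_X bs :: 'a::field fls) \<in> fls_one_units"
      "(q_cf fls_X cs :: 'a fls) \<in> fls_one_units"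
    and diff: "q_cf fls_X bs - q_cf fls_X cs \<in> (fls_Ints_ge n :: 'a fls set)"
  shows "q_cf fls_X (a # b # bs) - q_cf fls_X (a # b # cs)
    \<in> (fls_Ints_ge (a + b + n) :: 'a fls set)"
proof -
  define d :: "int list \<Rightarrow> 'a fls"
    where "d ds = fls_X * q_int fls_X b + inverse (q_cf fls_X ds)" for ds
  have "d bs - d cs \<in> fls_Ints_ge n"
    using units diff by (simp add: d_def fls_one_units_inverse_diff)
  then have "inverse (d bs) - inverse (d cs) \<in> fls_Ints_ge n"
    using assms(1) units by (simp add: d_def fls_one_units_inverse_diff q_cf_denominator_one_unit)
  then have "fls_X powi (a + b) * (inverse (d bs) - inverse (d cs)) \<in> fls_Ints_ge (a + b + n)"
    by (intro fls_Ints_ge_mult fls_X_powi_in_fls_Ints_ge)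
  then show ?thesis
    by (simp add: q_cf_Cons_Cons d_def right_diff_distrib del: fls_X_power_int)
qed

lemma q_cf_append_diff:
  assumes "\<forall>c\<in>set (tl as @ bs). 1 \<le> c"
  shows "q_cf fls_X (as @ bs) - q_cf fls_X as
    \<in> (fls_Ints_ge (sum_list as - 1) :: 'a::field fls set)"
  using assms
proof (induction as rule: induct_list012)
  case 1
  then have "q_cf fls_X bs \<in> (fls_Ints_ge 0 :: 'a fls set)"
    by (cases "bs = []")
      (simp_all add: zero_in_fls_Ints_ge fls_one_units_in_fls_Ints_ge q_cf_one_unit)
  then show ?case by (simp add: fls_Ints_ge_antimono)
next
  case (2 a)
  show ?case
  proof (cases bs)
    case Nil
    then show ?thesis by (simp add: zero_in_fls_Ints_ge)
  next
    case (Cons b cs)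
    with 2 have "q_cf fls_X (a # b # cs) - q_int fls_X a \<in> (fls_Ints_ge (a + b - 1) :: 'a fls set)"
      by (intro q_cf_Cons_Cons_diff_q_int q_cf_one_unit) auto
    with 2 Cons show ?thesis by (auto intro: fls_Ints_ge_antimono)
  qed
next
  case (3 a b cs)
  show ?case
  proof (cases "cs = []")
    case True
    have "(q_cf fls_X (a # b # bs) - q_int fls_X a) - (q_cf fls_X [a, b] - q_int fls_X a)
        \<in> (fls_Ints_ge (a + b - 1) :: 'a fls set)"
      using 3 by (intro fls_Ints_ge_diff q_cf_Cons_Cons_diff_q_int q_cf_one_unit) auto
    with True show ?thesis by simp
  next
    case False
    have "q_cf fls_X (cs @ bs) - q_cf fls_X cs \<in> (fls_Ints_ge (sum_list cs - 1) :: 'a fls set)"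
      using 3 by (cases cs) auto
    then have "q_cf fls_X (a # b # (cs @ bs)) - q_cf fls_X (a # b # cs)
        \<in> (fls_Ints_ge (a + b + (sum_list cs - 1)) :: 'a fls set)"
      using 3 False by (intro q_cf_Cons_Cons_diff q_cf_one_unit) auto
    then show ?thesis by (simp add: add_diff_eq add.assoc)
  qed
qed

lemma cf_trunc_Suc_append:
  "\<exists>bs. cf_trunc (Suc n) x = cf_trunc n x @ bs \<and> (bs = [] \<or> length (cf_trunc n x) = Suc n)"
proof (induction n arbitrary: x)
  case 0
  show ?case by simp
next
  case (Suc n)
  show ?case
  proof (cases "x \<in> \<int>")
    case False
    obtain bs where bs: "cf_trunc (Suc n) (1 / frac x) = cf_trunc n (1 / frac x) @ bs"
      "bs = [] \<or> length (cf_trunc n (1 / frac x)) = Suc n"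
      using Suc.IH by blast
    from bs(1) have "cf_trunc (Suc (Suc n)) x = cf_trunc (Suc n) x @ bs"
      unfolding cf_trunc.simps(2)[of "Suc n"] using False by simp
    with bs(2) False show ?thesis by auto
  qed simp
qed

lemma cf_trunc_eq_floor_Cons: "cf_trunc n x = \<lfloor>x\<rfloor> # tl (cf_trunc n x)"
  by (cases n) auto

lemma q_cf_cf_trunc_Suc_diff:
  "q_cf fls_X (cf_trunc (Suc n) x) - q_cf fls_X (cf_trunc n x)
    \<in> (fls_Ints_ge (\<lfloor>x\<rfloor> - 1 + int n) :: 'a::field fls set)"
proof -
  define as where "as = cf_trunc n x"
  have as: "as = \<lfloor>x\<rfloor> # tl as" unfolding as_def by (rule cf_trunc_eq_floor_Cons)
  obtain bs where bs: "cf_trunc (Suc n) x = as @ bs" "bs = [] \<or> length as = Suc n"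
    using cf_trunc_Suc_append unfolding as_def by blast
  show ?thesis
  proof (cases "bs = []")
    case False
    have pos: "\<forall>c\<in>set (tl as @ bs). 1 \<le> c"
      using cf_trunc_tl_pos[of _ "Suc n" x] as unfolding bs(1) by (metis list.sel(3) append_Cons)
    then have "(\<Sum>c\<leftarrow>tl as. 1) \<le> (\<Sum>c\<leftarrow>tl as. c)"
      by (intro sum_list_mono) auto
    then have "int n \<le> sum_list (tl as)"
      using False bs(2) by (simp add: sum_list_triv)
    then have "\<lfloor>x\<rfloor> - 1 + int n \<le> sum_list as - 1"
      by (subst as) simp
    with q_cf_append_diff[OF pos] show ?thesis
      unfolding bs(1) as_def by (rule fls_Ints_ge_antimono)
  qed (simp add: bs(1) zero_in_fls_Ints_ge as_def del: cf_trunc.simps)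
qed

lemma q_real_diff_q_cf_cf_trunc:
  "q_real x - q_cf fls_X (cf_trunc n x) \<in> fls_Ints_ge (\<lfloor>x\<rfloor> - 1 + int n)"
proof -
  obtain l :: "rat fls"
    where l: "\<And>n. l - q_cf fls_X (cf_trunc n x) \<in> fls_Ints_ge (\<lfloor>x\<rfloor> - 1 + int n)"
    using fls_Ints_ge_complete[where s = "\<lambda>n. q_cf fls_X (cf_trunc n x)"]
      q_cf_cf_trunc_Suc_diff by blast
  then have "q_real x = l" unfolding q_real_def by (intro limI fls_Ints_ge_LIMSEQ)
  with l show ?thesis by simp
qed

lemma q_real_leading_terms:
  assumes "x \<notin> \<int>" and e: "e = \<lfloor>x\<rfloor> + \<lceil>1 / frac x\<rceil> - 1"
  shows "q_real x - (q_int fls_X \<lfloor>x\<rfloor> + fls_X powi e) \<in> fls_Ints_ge (e + 1)"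
proof (rule fls_Ints_ge_diff_trans)
  define y where "y = 1 / frac x"
  define n where "n = nat (e + 2 - \<lfloor>x\<rfloor>)"
  define bs where "bs = (if y \<in> \<int> then [] else cf_trunc n (1 / frac y))"
  have cf: "cf_trunc (Suc (Suc n)) x = \<lfloor>x\<rfloor> # \<lfloor>y\<rfloor> # bs"
    using assms(1) by (simp add: y_def bs_def)
  show "q_real x - q_cf fls_X (\<lfloor>x\<rfloor> # \<lfloor>y\<rfloor> # bs) \<in> fls_Ints_ge (e + 1)"
    using q_real_diff_q_cf_cf_trunc[of x "Suc (Suc n)"] unfolding cf
    by (rule fls_Ints_ge_antimono) (simp add: n_def)
  have "1 \<le> \<lfloor>y\<rfloor>" "\<forall>b\<in>set bs. 1 \<le> b"
    using cf_trunc_tl_pos[of _ "Suc (Suc n)" x] unfolding cf list.sel by (metis list.set_intros)+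
  moreover have "e = \<lfloor>x\<rfloor> + \<lfloor>y\<rfloor> - of_bool (bs = [])"
    by (auto simp: e bs_def ceiling_altdef Ints_def simp flip: y_def)
  ultimately show "q_cf fls_X (\<lfloor>x\<rfloor> # \<lfloor>y\<rfloor> # bs) - (q_int fls_X \<lfloor>x\<rfloor> + fls_X powi e)
      \<in> (fls_Ints_ge (e + 1) :: rat fls set)"
    by (intro q_cf_Cons_Cons_leading_terms q_cf_one_unit)
qed

lemma floor_plus_unit_fraction_le_iff:
  fixes x :: real
  assumes "x \<notin> \<int>" "0 < n"
  shows "of_int \<lfloor>x\<rfloor> + 1 / real n \<le> x \<longleftrightarrow> \<lceil>1 / frac x\<rceil> \<le> int n"
proof -
  have "of_int \<lfloor>x\<rfloor> + 1 / real n \<le> x \<longleftrightarrow> 1 / real n \<le> frac x"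
    by (simp add: frac_def algebra_simps)
  also have "\<dots> \<longleftrightarrow> 1 / frac x \<le> real n"
    using assms frac_gt_0_iff[of x] by (simp add: field_simps)
  finally show ?thesis by (simp add: ceiling_le_iff)
qed

lemma q_real_leading_terms_unit_fraction_interval:
  fixes x :: real and k n :: nat
  assumes "0 < n" "real k \<le> x" "x < real k + 1 / real n"
  shows "q_real x - (q_int fls_X (int k)
      + (if real k + 1 / (real n + 1) \<le> x then fls_X ^ (k + n) else 0))
    \<in> fls_Ints_ge (int (k + n + 1))"
proof (cases "x = real k")
  case True
  moreover have "\<not> real k + 1 / (real n + 1) \<le> real k" by (simp add: field_simps)
  ultimately show ?thesis using q_real_of_int[of "int k"] by (simp add: zero_in_fls_Ints_ge)
next
  case False
  have "1 / real n \<le> 1" using assms(1) by simp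
  then have floor: "\<lfloor>x\<rfloor> = int k" using assms by linarith
  then have nonint: "x \<notin> \<int>" using False by (auto elim!: Ints_cases)
  define e where "e = int k + \<lceil>1 / frac x\<rceil> - 1"
  have e_ge: "int (k + n) \<le> e"
    using floor_plus_unit_fraction_le_iff[OF nonint assms(1)] assms(3) by (simp add: e_def floor)
  have e_eq: "real k + 1 / (real n + 1) \<le> x \<longleftrightarrow> e = int (k + n)"
    using floor_plus_unit_fraction_le_iff[OF nonint, of "Suc n"] e_ge
    by (auto simp: e_def floor add.commute)
  have leading: "q_real x - (q_int fls_X (int k) + fls_X powi e) \<in> fls_Ints_ge (e + 1)"
    using q_real_leading_terms[OF nonint] by (simp add: e_def floor)
  show ?thesis
  proof (cases "e = int (k + n)")
    case True
    with leading show ?thesis unfolding e_eq True power_int_of_nat by (simp add: algebra_simps)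
  next
    case False
    with e_ge have e_gt: "int (k + n + 1) \<le> e" by simp
    have "q_real x - (q_int fls_X (int k) + fls_X powi e) \<in> fls_Ints_ge (int (k + n + 1))"
      by (rule fls_Ints_ge_antimono[OF leading]) (use e_gt in simp)
    from fls_Ints_ge_add[OF this fls_Ints_ge_antimono[OF fls_X_powi_in_fls_Ints_ge e_gt]]
    show ?thesis using False by (simp add: e_eq)
  qed
qed

theorem theorem2p4:
  fixes x :: real and k n :: nat
  assumes "0 < n" and "real k \<le> x" and "x < real k + 1 / real n"
  shows "\<exists>\<kappa> :: nat \<Rightarrow> int. q_real x = fps_to_fls
    ((\<Sum>i<k. fps_X ^ i)
      + (if real k + 1 / (real n + 1) \<le> x then fps_X ^ (k + n) else 0)
      + Abs_fps (\<lambda>i. if k + n + 1 \<le> i then of_int (\<kappa> i) else 0))"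
proof -
  obtain \<kappa> :: "nat \<Rightarrow> int" where
    "q_real x - (q_int fls_X (int k)
        + (if real k + 1 / (real n + 1) \<le> x then fls_X ^ (k + n) else 0))
      = fps_to_fls (Abs_fps (\<lambda>i. if k + n + 1 \<le> i then of_int (\<kappa> i) else 0))"
    using fls_Ints_ge_imp_fps_to_fls[OF q_real_leading_terms_unit_fraction_interval[OF assms]]
    by blast
  then show ?thesis
    by (intro exI[of _ \<kappa>])
      (simp add: q_int_fls_X_eq_fps_to_fls fps_to_fls_power diff_eq_eq add.commute)
qed

end
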